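(* Let $p$ be either of the two mesh patterns $p_1=(12,\{(0,1),(1,0),(1,1),(1,2),(2,1)\})$ and $p_2=(12,\{(0,1),(0,2),(1,0),(1,1),(1,2)\})$. Let $T_{n,k}$ be the number of permutations in $S_n$ with exactly $k$ occurrences of $p$, and let $T_n(x)=\sum_{k=0}^{n-1}T_{n,k}x^k$. Then for all $n\ge 3$ and $k\ge 0$, $$T_{n,k} = T_{n-1,k-1}+ (k+1)T_{n-1,k+1} + (n-k-1)T_{n-1,k},$$ with the initial conditions $T_{1,0}=1$, $T_{2,0}=1$, $T_{2,1}=1$. Equivalently, for all $n\ge 3$, $$T_n(x) =(x+n-1) T_{n-1}(x)+(1-x) T'_{n-1}(x),$$ with the initial conditions $T_1(x)=1$ and $T_2(x)=1+x$.
   Context: $S_n$ is the set of permutations $\pi=\pi_1\cdots\pi_n$ of $\{1,\dots,n\}$. A mesh pattern $(12,R)$ consists of the permutation $12$ and a set $R\subseteq\{0,1,2\}\times\{0,1,2\}$ of shaded boxes. An occurrence of $(12,R)$ in $\pi\in S_n$ is a pair of positions $s<t$ with $\pi_s<\pi_t$ such that, putting $s_0=0,\ s_1=s,\ s_2=t,\ s_3=n+1$ and $v_0=0,\ v_1=\pi_s,\ v_2=\pi_t,\ v_3=n+1$, for every $(i,j)\in R$ there is no position $m$ with $s_i<m<s_{i+1}$ and $v_j<\pi_m<v_{j+1}$. By convention $T_{n,-1}=0$. $T'_n(x)$ is the derivative of $T_n(x)$ with respect to $x$. *)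

theory Defs
  imports "HOL-Combinatorics.Permutations" "HOL-Computational_Algebra.Polynomial"
begin

text \<open>
  A permutation in \<open>S\<^sub>n\<close> is a function \<open>\<pi>\<close> with \<open>\<pi> permutes {1..n}\<close>; \<open>\<pi> i\<close> is its \<open>i\<close>-th letter.
  A mesh pattern \<open>(12, R)\<close> is represented by its set \<open>R\<close> of shaded boxes.
  In the lists below, entry \<open>i\<close> is \<open>s\<^sub>i\<close> resp. \<open>v\<^sub>i\<close>; the indices stay in range
  for \<open>R \<subseteq> {0,1,2} \<times> {0,1,2}\<close>.
\<close>

definition mesh12_occurrences ::
    "(nat \<times> nat) set \<Rightarrow> nat \<Rightarrow> (nat \<Rightarrow> nat) \<Rightarrow> (nat \<times> nat) set" where
  "mesh12_occurrences R n \<pi> =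
    {(s, t). s \<in> {1..n} \<and> t \<in> {1..n} \<and> s < t \<and> \<pi> s < \<pi> t \<and>
      (\<forall>(i, j) \<in> R. \<not> (\<exists>m \<in> {1..n}.
         [0, s, t, n + 1] ! i < m \<and> m < [0, s, t, n + 1] ! (i + 1) \<and>
         [0, \<pi> s, \<pi> t, n + 1] ! j < \<pi> m \<and> \<pi> m < [0, \<pi> s, \<pi> t, n + 1] ! (j + 1)))}"

definition pattern1 :: "(nat \<times> nat) set" where
  "pattern1 = {(0,1), (1,0), (1,1), (1,2), (2,1)}"

definition pattern2 :: "(nat \<times> nat) set" where
  "pattern2 = {(0,1), (0,2), (1,0), (1,1), (1,2)}"

text \<open>
  The index \<open>k\<close> is an integer, so that the convention \<open>T\<^sub>n\<^sub>,\<^sub>-\<^sub>1 = 0\<close> holds because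
  no permutation has a negative number of occurrences.
\<close>

definition T :: "(nat \<times> nat) set \<Rightarrow> nat \<Rightarrow> int \<Rightarrow> nat" where
  "T R n k = card {\<pi>. \<pi> permutes {1..n} \<and> int (card (mesh12_occurrences R n \<pi>)) = k}"

definition T_poly :: "(nat \<times> nat) set \<Rightarrow> nat \<Rightarrow> int poly" where
  "T_poly R n = (\<Sum>k<n. monom (int (T R n (int k))) k)"

end

theory Submission
  imports Defs
begin

text \<open>
  Both patterns shade the whole middle column, so an occurrence occupies two adjacent positions
  \<open>s, s + 1\<close> and is determined by \<open>s\<close>. In the first pattern the shaded middle row forces
  \<open>\<pi> (s + 1) = \<pi> s + 1\<close>; in the second the two boxes to the left force \<open>\<pi> s\<close> and
  \<open>\<pi> (s + 1)\<close> to be left-to-right maxima (\<open>pattern1_occurrences\<close>, \<open>pattern2_occurrences\<close>).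

  Every permutation of size \<open>m + 1\<close> arises exactly once from a permutation \<open>\<pi>\<close> of size \<open>m\<close>
  by raising all letters by one and inserting the letter \<open>1\<close> at one of \<open>m + 1\<close> places
  (\<open>insert_min_bij\<close>). For both
  patterns the effect on the occurrences is the same. There is one place that creates an
  occurrence and destroys none: immediately before the old minimum for the first pattern, at
  the very front for the second. Inserting \<open>1\<close> in the middle of an occurrence destroys that
  occurrence only. All other places change nothing. Hence a permutation with \<open>k\<close> occurrences
  has one child with \<open>k + 1\<close>, \<open>k\<close> children with \<open>k - 1\<close>, and \<open>m - k\<close> children with \<open>k\<close>
  occurrences, which is the recurrence (\<open>insertion_recurrence\<close>); it already holds for \<open>m = 1\<close>, which
  gives the initial values for size two.
  The polynomial identity is the recurrence read off coefficientwise.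
\<close>

section \<open>Inserting a new minimum\<close>

text \<open>Outside \<open>{1..m + 1}\<close> the value must be \<open>i\<close> itself for the result to be a permutation of
  that set in the sense of \<open>permutes\<close>.\<close>

definition insert_min :: "nat \<Rightarrow> (nat \<Rightarrow> nat) \<Rightarrow> nat \<Rightarrow> nat \<Rightarrow> nat" where
  "insert_min m \<pi> g i =
    (if i = 0 \<or> Suc m < i then i
     else if i < g then Suc (\<pi> i) else if i = g then 1 else Suc (\<pi> (i - 1)))"

lemma permutes_interval_bounds:
  fixes \<pi> :: "nat \<Rightarrow> nat"
  assumes "\<pi> permutes {1..m}" "1 \<le> i" "i \<le> m"
  shows "1 \<le> \<pi> i" "\<pi> i \<le> m"
  using permutes_in_image[OF assms(1), of i] assms(2,3) by auto

lemma insert_min_permutes: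
  assumes \<pi>: "\<pi> permutes {1..m}" and g: "g \<in> {1..Suc m}"
  shows "insert_min m \<pi> g permutes {1..Suc m}"
proof -
  have inj: "\<pi> a = \<pi> b \<longleftrightarrow> a = b" for a b
    using permutes_inj[OF \<pi>] by (auto dest: injD)
  note bounds = permutes_interval_bounds[OF \<pi>]
  have pos: "0 < \<pi> i" if "1 \<le> i" "i \<le> m" for i
    using bounds[OF that] by simp
  have maps: "insert_min m \<pi> g ` {1..Suc m} \<subseteq> {1..Suc m}"
    using g bounds by (auto simp: insert_min_def)
  have "inj_on (insert_min m \<pi> g) {1..Suc m}"
  proof (rule linorder_inj_onI)
    fix i j assume "i < j" "i \<in> {1..Suc m}" "j \<in> {1..Suc m}"
    then show "insert_min m \<pi> g i \<noteq> insert_min m \<pi> g j"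
      using g pos[of i] pos[of "j - 1"] by (auto simp: insert_min_def inj)
  qed auto
  with maps have "bij_betw (insert_min m \<pi> g) {1..Suc m} {1..Suc m}"
    by (simp add: bij_betw_def endo_inj_surj)
  then show ?thesis
    by (rule bij_imp_permutes) (auto simp: insert_min_def)
qed

lemma insert_min_inj:
  assumes "\<pi> permutes {1..m}" "\<pi>' permutes {1..m}"
    and "g \<in> {1..Suc m}" "g' \<in> {1..Suc m}"
    and eq: "insert_min m \<pi> g = insert_min m \<pi>' g'"
  shows "\<pi> = \<pi>' \<and> g = g'"
proof -
  have "insert_min m \<pi> g g = 1" "insert_min m \<pi>' g' g' = 1"
    using assms(3,4) by (simp_all add: insert_min_def)
  then have "insert_min m \<pi> g g' = insert_min m \<pi> g g"
    using eq by simp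
  then have g: "g = g'"
    using permutes_inj[OF insert_min_permutes[OF assms(1,3)]] by (auto dest: injD)
  have "\<pi> i = \<pi>' i" for i
  proof (cases "i \<in> {1..m}")
    case True
    then show ?thesis
      using fun_cong[OF eq, of "if i < g then i else Suc i"] g
      by (auto simp: insert_min_def split: if_splits)
  next
    case False
    then show ?thesis using assms(1,2) by (auto simp: permutes_def)
  qed
  with g show ?thesis by auto
qed

text \<open>Surjectivity needs no explicit deletion map: \<open>(m + 1) * m! = (m + 1)!\<close>.\<close>

lemma insert_min_bij:
  "bij_betw (\<lambda>(\<pi>, g). insert_min m \<pi> g)
     ({\<pi>. \<pi> permutes {1..m}} \<times> {1..Suc m}) {\<pi>. \<pi> permutes {1..Suc m}}"
    (is "bij_betw ?f ?A ?B")
proof -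
  have inj: "inj_on ?f ?A"
  proof (rule inj_onI)
    fix x y assume "x \<in> ?A" "y \<in> ?A" "?f x = ?f y"
    then show "x = y"
      using insert_min_inj[of "fst x" m "fst y" "snd x" "snd y"]
      by (simp add: mem_Times_iff case_prod_beta prod_eq_iff)
  qed
  have sub: "?f ` ?A \<subseteq> ?B"
    using insert_min_permutes by auto
  have fin: "finite ?B" by (simp add: finite_permutations)
  have "card (?f ` ?A) = card ?B"
    using inj by (simp add: card_image card_cartesian_product card_permutations)
  then have "?f ` ?A = ?B"
    using card_subset_eq[OF fin sub] by simp
  with inj show ?thesis by (simp add: bij_betw_def)
qed

section \<open>The recurrence from the insertion rule\<close>

text \<open>The counting argument: \<open>e\<close> is the place that creates an occurrence, and \<open>D\<close> is the
  set of places that destroy one, as many as there are occurrences. The numbers are integers so that \<open>k - 1\<close> may be negative.\<close>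

lemma insertion_recurrence:
  fixes F G :: "(nat \<Rightarrow> nat) \<Rightarrow> int"
  assumes step: "\<And>\<pi>. \<pi> permutes {1..m} \<Longrightarrow>
    \<exists>e D. e \<in> {1..Suc m} \<and> D \<subseteq> {1..Suc m} - {e} \<and> int (card D) = F \<pi> \<and>
      (\<forall>g \<in> {1..Suc m}. G (insert_min m \<pi> g) =
        (if g = e then F \<pi> + 1 else if g \<in> D then F \<pi> - 1 else F \<pi>))"
  shows "int (card {\<pi>. \<pi> permutes {1..Suc m} \<and> G \<pi> = k}) =
    int (card {\<pi>. \<pi> permutes {1..m} \<and> F \<pi> = k - 1})
    + (k + 1) * int (card {\<pi>. \<pi> permutes {1..m} \<and> F \<pi> = k + 1})
    + (int m - k) * int (card {\<pi>. \<pi> permutes {1..m} \<and> F \<pi> = k})"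
proof -
  let ?P = "{\<pi>. \<pi> permutes {1..m}}" and ?Q = "{\<pi>. \<pi> permutes {1..Suc m}}"
  have card_ind: "int (card {x. x permutes S \<and> H x = c}) =
      (\<Sum>x | x permutes S. of_bool (H x = c))"
    if "finite S" for S :: "nat set" and H and c :: int
  proof -
    have "{x. x permutes S \<and> H x = c} = {x. x permutes S} \<inter> {x. H x = c}" by auto
    then show ?thesis using finite_permutations[OF that] by simp
  qed
  have children: "(\<Sum>g \<in> {1..Suc m}. of_bool (G (insert_min m \<pi> g) = k)) =
      of_bool (F \<pi> = k - 1) + (k + 1) * of_bool (F \<pi> = k + 1)
        + (int m - k) * of_bool (F \<pi> = k)"
    if \<pi>: "\<pi> \<in> ?P" for \<pi>
  proof -
    from step[of \<pi>] \<pi> obtain e D where e: "e \<in> {1..Suc m}" and D: "D \<subseteq> {1..Suc m} - {e}"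
      and cD: "int (card D) = F \<pi>"
      and G: "\<forall>g \<in> {1..Suc m}. G (insert_min m \<pi> g) =
        (if g = e then F \<pi> + 1 else if g \<in> D then F \<pi> - 1 else F \<pi>)"
      by auto
    let ?N = "{1..Suc m} - {e} - D"
    have split: "{1..Suc m} = insert e (D \<union> ?N)" using e D by auto
    have finD: "finite D" using D by (auto intro: finite_subset)
    have cm: "card ({1..Suc m} - {e}) = m" using e by simp
    then have "card D \<le> m" using card_mono[OF _ D] by simp
    moreover have "card ?N = m - card D" using card_Diff_subset[OF finD D] cm by simp
    ultimately have cN: "int (card ?N) = int m - F \<pi>" using cD by simp
    let ?f = "\<lambda>g. of_bool (G (insert_min m \<pi> g) = k) :: int"
    have "e \<notin> D \<union> ?N" "D \<inter> ?N = {}" using D by auto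
    then have "sum ?f (insert e (D \<union> ?N)) = ?f e + (sum ?f D + sum ?f ?N)"
      using finD sum.insert[of "D \<union> ?N" e ?f] sum.union_disjoint[of D ?N ?f]
      by (simp only: finite_Un finite_Diff finite_atLeastAtMost simp_thms)
    moreover have "?f e = of_bool (F \<pi> + 1 = k)" using G e by simp
    moreover have "sum ?f D = (\<Sum>g \<in> D. of_bool (F \<pi> - 1 = k))"
      by (rule sum.cong[OF refl], subst G[rule_format]) (use D in auto)
    moreover have "sum ?f ?N = (\<Sum>g \<in> ?N. of_bool (F \<pi> = k))"
      by (rule sum.cong[OF refl], subst G[rule_format]) auto
    moreover have "(\<Sum>g \<in> D. of_bool (F \<pi> - 1 = k)) = F \<pi> * of_bool (F \<pi> - 1 = k)"
      using cD by (simp only: sum_constant)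
    moreover have "(\<Sum>g \<in> ?N. of_bool (F \<pi> = k)) = (int m - F \<pi>) * of_bool (F \<pi> = k)"
      using cN by (simp only: sum_constant)
    ultimately have "sum ?f {1..Suc m} = of_bool (F \<pi> + 1 = k) + (F \<pi> * of_bool (F \<pi> - 1 = k)
        + (int m - F \<pi>) * of_bool (F \<pi> = k))"
      using split by metis
    then show ?thesis by (auto simp only: of_bool_def split: if_splits)
  qed
  have "int (card {\<pi>. \<pi> permutes {1..Suc m} \<and> G \<pi> = k}) = (\<Sum>\<pi> \<in> ?Q. of_bool (G \<pi> = k))"
    by (rule card_ind) simp
  also have "\<dots> = (\<Sum>(\<pi>, g) \<in> ?P \<times> {1..Suc m}. of_bool (G (insert_min m \<pi> g) = k))"
    using sum.reindex_bij_betw[OF insert_min_bij, of "\<lambda>\<sigma>. of_bool (G \<sigma> = k) :: int" m]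
    by (simp add: case_prod_beta)
  also have "\<dots> = (\<Sum>\<pi> \<in> ?P. \<Sum>g \<in> {1..Suc m}. of_bool (G (insert_min m \<pi> g) = k))"
    by (rule sum.cartesian_product[symmetric])
  also have "\<dots> = (\<Sum>\<pi> \<in> ?P. of_bool (F \<pi> = k - 1) + (k + 1) * of_bool (F \<pi> = k + 1)
        + (int m - k) * of_bool (F \<pi> = k))"
    by (rule sum.cong[OF refl children])
  also have "\<dots> = int (card {\<pi>. \<pi> permutes {1..m} \<and> F \<pi> = k - 1})
    + (k + 1) * int (card {\<pi>. \<pi> permutes {1..m} \<and> F \<pi> = k + 1})
    + (int m - k) * int (card {\<pi>. \<pi> permutes {1..m} \<and> F \<pi> = k})"
    by (simp only: card_ind[OF finite_atLeastAtMost] sum.distrib sum_distrib_left)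
  finally show ?thesis .
qed

text \<open>
  \<open>A\<close> and \<open>B\<close> stand for the starting positions of the adjacent occurrences before and after
  an insertion at \<open>g\<close>: those starting at \<open>s < g - 1\<close> stay, those starting at \<open>s \<ge> g\<close> move
  right by one, the one at \<open>g - 1\<close> is torn apart, and \<open>new\<close> says whether one starts at \<open>g\<close>.
\<close>

lemma card_after_insertion:
  fixes A B :: "nat set"
  assumes fin: "finite A" and g: "1 \<le> g"
    and left: "\<And>s. Suc s < g \<Longrightarrow> s \<in> B \<longleftrightarrow> s \<in> A"
    and cut: "g - 1 \<notin> B"
    and here: "g \<in> B \<longleftrightarrow> new"
    and right: "\<And>s. g \<le> s \<Longrightarrow> Suc s \<in> B \<longleftrightarrow> s \<in> A"
  shows "int (card B) = int (card A) + of_bool new - of_bool (g - 1 \<in> A)"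
proof -
  let ?h = "\<lambda>s. if s < g then s else Suc s"
  have B: "B = ?h ` (A - {g - 1}) \<union> (if new then {g} else {})"
  proof (rule set_eqI)
    fix s
    consider "Suc s < g" | "Suc s = g" | "s = g" | r where "s = Suc r" "g \<le> r"
      by (cases s) (use g in \<open>auto simp: not_less le_less; fail\<close>, force)
    then show "s \<in> B \<longleftrightarrow> s \<in> ?h ` (A - {g - 1}) \<union> (if new then {g} else {})"
    proof cases
      case 1
      then show ?thesis using left[OF 1] by (auto simp: image_iff split: if_splits)
    next
      case 2
      then show ?thesis using cut by (auto split: if_splits)
    next
      case 3
      then show ?thesis using here by (auto split: if_splits)
    next
      case 4
      then show ?thesis using right[of r] g by (auto simp: image_iff split: if_splits)
    qed
  qed
  have "inj_on ?h (A - {g - 1})" by (auto simp: inj_on_def split: if_splits)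
  then have "card (?h ` (A - {g - 1})) = card (A - {g - 1})" by (rule card_image)
  moreover have "card B = card (?h ` (A - {g - 1})) + of_bool new"
    unfolding B using fin by (subst card_Un_disjoint) (auto split: if_splits)
  moreover have "int (card (A - {g - 1})) = int (card A) - of_bool (g - 1 \<in> A)"
  proof (cases "g - 1 \<in> A")
    case True
    then show ?thesis unfolding card.remove[OF fin True] by simp
  qed simp
  ultimately show ?thesis by simp
qed

text \<open>\<open>starts m \<pi>\<close> plays the role of the set of starting positions of adjacent occurrences,
  and \<open>e \<pi>\<close> is the place whose use creates a new one.\<close>

lemma T_recurrence_from_starts:
  fixes starts :: "nat \<Rightarrow> (nat \<Rightarrow> nat) \<Rightarrow> nat set"
  assumes occ: "\<And>n \<pi>. \<pi> permutes {1..n} \<Longrightarrow>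
      mesh12_occurrences R n \<pi> = (\<lambda>s. (s, Suc s)) ` starts n \<pi>"
    and range: "\<And>n \<pi>. starts n \<pi> \<subseteq> {1..<n}"
    and e: "\<And>\<pi>. \<pi> permutes {1..m} \<Longrightarrow> e \<pi> \<in> {1..Suc m} \<and> e \<pi> - 1 \<notin> starts m \<pi>"
    and left: "\<And>\<pi> g s. \<pi> permutes {1..m} \<Longrightarrow> g \<in> {1..Suc m} \<Longrightarrow> Suc s < g \<Longrightarrow>
      s \<in> starts (Suc m) (insert_min m \<pi> g) \<longleftrightarrow> s \<in> starts m \<pi>"
    and cut: "\<And>\<pi> g. \<pi> permutes {1..m} \<Longrightarrow> g \<in> {1..Suc m} \<Longrightarrow>
      g - 1 \<notin> starts (Suc m) (insert_min m \<pi> g)"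
    and here: "\<And>\<pi> g. \<pi> permutes {1..m} \<Longrightarrow> g \<in> {1..Suc m} \<Longrightarrow>
      g \<in> starts (Suc m) (insert_min m \<pi> g) \<longleftrightarrow> g = e \<pi>"
    and right: "\<And>\<pi> g s. \<pi> permutes {1..m} \<Longrightarrow> g \<in> {1..Suc m} \<Longrightarrow> g \<le> s \<Longrightarrow>
      Suc s \<in> starts (Suc m) (insert_min m \<pi> g) \<longleftrightarrow> s \<in> starts m \<pi>"
  shows "int (T R (Suc m) k) = int (T R m (k - 1)) + (k + 1) * int (T R m (k + 1))
           + (int m - k) * int (T R m k)"
  unfolding T_def
proof (rule insertion_recurrence)
  fix \<pi> assume \<pi>: "\<pi> permutes {1..m}"
  let ?A = "starts m \<pi>"
  have card_occ: "card (mesh12_occurrences R n \<sigma>) = card (starts n \<sigma>)"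
    if "\<sigma> permutes {1..n}" for n \<sigma>
    unfolding occ[OF that] by (rule card_image) (auto simp: inj_on_def)
  have fin: "finite ?A" using range[of m \<pi>] by (rule finite_subset) simp
  have "e \<pi> \<notin> Suc ` ?A"
    using e[OF \<pi>] by (metis diff_Suc_1 imageE)
  moreover have "Suc ` ?A \<subseteq> {1..Suc m}"
    using range[of m \<pi>] by auto
  ultimately have "Suc ` ?A \<subseteq> {1..Suc m} - {e \<pi>}" by blast
  moreover have "int (card (Suc ` ?A)) = int (card (mesh12_occurrences R m \<pi>))"
    by (simp add: card_occ[OF \<pi>] card_image)
  moreover have "int (card (mesh12_occurrences R (Suc m) (insert_min m \<pi> g))) =
     (if g = e \<pi> then int (card (mesh12_occurrences R m \<pi>)) + 1
      else if g \<in> Suc ` ?A then int (card (mesh12_occurrences R m \<pi>)) - 1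
      else int (card (mesh12_occurrences R m \<pi>)))"
    if g: "g \<in> {1..Suc m}" for g
  proof -
    have mem: "g \<in> Suc ` ?A \<longleftrightarrow> g - 1 \<in> ?A" using g by (cases g) auto
    have "int (card (starts (Suc m) (insert_min m \<pi> g))) =
        int (card ?A) + of_bool (g = e \<pi>) - of_bool (g - 1 \<in> ?A)"
      by (rule card_after_insertion) (use fin g left[OF \<pi> g] cut[OF \<pi> g] here[OF \<pi> g]
          right[OF \<pi> g] in auto)
    then show ?thesis
      using e[OF \<pi>] by (auto simp: card_occ[OF \<pi>] card_occ[OF insert_min_permutes[OF \<pi> g]] mem)
  qed
  ultimately show "\<exists>e D. e \<in> {1..Suc m} \<and> D \<subseteq> {1..Suc m} - {e} \<and>
      int (card D) = int (card (mesh12_occurrences R m \<pi>)) \<and>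
      (\<forall>g \<in> {1..Suc m}. int (card (mesh12_occurrences R (Suc m) (insert_min m \<pi> g))) =
        (if g = e then int (card (mesh12_occurrences R m \<pi>)) + 1
         else if g \<in> D then int (card (mesh12_occurrences R m \<pi>)) - 1
         else int (card (mesh12_occurrences R m \<pi>))))"
    using e[OF \<pi>] by (intro exI[of _ "e \<pi>"] exI[of _ "Suc ` ?A"]) blast
qed

section \<open>Occurrences of the two patterns\<close>

definition succession_starts :: "nat \<Rightarrow> (nat \<Rightarrow> nat) \<Rightarrow> nat set" where
  "succession_starts n \<pi> = {s \<in> {1..<n}. \<pi> (Suc s) = Suc (\<pi> s)}"

text \<open>If \<open>\<pi> s\<close> is a left-to-right maximum and \<open>\<pi> s < \<pi> (Suc s)\<close>, then \<open>\<pi> (Suc s)\<close> is one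
  as well.\<close>

definition adjacent_records_starts :: "nat \<Rightarrow> (nat \<Rightarrow> nat) \<Rightarrow> nat set" where
  "adjacent_records_starts n \<pi> =
    {s \<in> {1..<n}. \<pi> s < \<pi> (Suc s) \<and> (\<forall>j \<in> {1..<s}. \<pi> j < \<pi> s)}"

text \<open>A letter at position \<open>s + 1\<close> strictly between the two positions would have a value
  below, between or above the two values, hence lie in a shaded box of the middle column.\<close>

lemma middle_column_shaded_imp_adjacent:
  assumes \<pi>: "\<pi> permutes {1..n}" and R: "{(1,0), (1,1), (1,2)} \<subseteq> R"
    and occ: "(s, t) \<in> mesh12_occurrences R n \<pi>"
  shows "t = Suc s"
proof (rule ccontr)
  assume "t \<noteq> Suc s"
  with occ have st: "Suc s < t" "1 \<le> s" "t \<le> n" by (auto simp: mesh12_occurrences_def)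
  let ?v = "\<pi> (Suc s)"
  have "?v \<noteq> \<pi> s" "?v \<noteq> \<pi> t"
    using permutes_inj[OF \<pi>] st by (auto dest!: injD)
  moreover have "1 \<le> ?v" "?v \<le> n" using permutes_interval_bounds[OF \<pi>, of "Suc s"] st by auto
  ultimately have "?v < \<pi> s \<and> 0 < ?v \<or> \<pi> s < ?v \<and> ?v < \<pi> t \<or> \<pi> t < ?v \<and> ?v < Suc n"
    by auto
  moreover have "\<not> (\<exists>m \<in> {1..n}. [0, s, t, n + 1] ! 1 < m \<and> m < [0, s, t, n + 1] ! (1 + 1) \<and>
         [0, \<pi> s, \<pi> t, n + 1] ! j < \<pi> m \<and> \<pi> m < [0, \<pi> s, \<pi> t, n + 1] ! (j + 1))"
    if "(1, j) \<in> R" for j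
    using occ that unfolding mesh12_occurrences_def by blast
  then have "\<not> ([0, \<pi> s, \<pi> t, n + 1] ! j < ?v \<and> ?v < [0, \<pi> s, \<pi> t, n + 1] ! (j + 1))"
    if "(1, j) \<in> R" for j
    using that st by force
  from this[of 0] this[of 1] this[of 2]
  have "\<not> (0 < ?v \<and> ?v < \<pi> s)" "\<not> (\<pi> s < ?v \<and> ?v < \<pi> t)" "\<not> (\<pi> t < ?v \<and> ?v < Suc n)"
    using R by (auto simp: eval_nat_numeral)
  ultimately show False by auto
qed

lemma pattern1_occurrences:
  assumes \<pi>: "\<pi> permutes {1..n}"
  shows "mesh12_occurrences pattern1 n \<pi> = (\<lambda>s. (s, Suc s)) ` succession_starts n \<pi>"
proof (rule set_eqI, clarify)
  fix s t
  show "(s, t) \<in> mesh12_occurrences pattern1 n \<pi> \<longleftrightarrow>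
      (s, t) \<in> (\<lambda>s. (s, Suc s)) ` succession_starts n \<pi>"
  proof
    assume occ: "(s, t) \<in> mesh12_occurrences pattern1 n \<pi>"
    have t: "t = Suc s"
      by (rule middle_column_shaded_imp_adjacent[OF \<pi> _ occ]) (auto simp: pattern1_def)
    from occ have lt: "1 \<le> s" "Suc s \<le> n" "\<pi> s < \<pi> (Suc s)"
      by (auto simp: mesh12_occurrences_def t)
    from occ have row: "\<not> (\<pi> s < \<pi> m \<and> \<pi> m < \<pi> (Suc s))"
      if "m \<in> {1..n}" "m < s \<or> Suc s < m" for m
      using that by (auto simp: mesh12_occurrences_def pattern1_def t eval_nat_numeral)
    have "\<pi> (Suc s) = Suc (\<pi> s)"
    proof (rule ccontr)
      assume ne: "\<pi> (Suc s) \<noteq> Suc (\<pi> s)"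
      have "Suc (\<pi> s) \<in> {1..n}"
        using permutes_interval_bounds[OF \<pi>, of "Suc s"] lt by auto
      then obtain m where m: "m \<in> {1..n}" "\<pi> m = Suc (\<pi> s)"
        using permutes_image[OF \<pi>] by (metis imageE)
      then have "m \<noteq> s" "m \<noteq> Suc s" using ne by auto
      then have "m < s \<or> Suc s < m" by linarith
      then show False using row[OF m(1)] m lt ne by simp
    qed
    with t lt show "(s, t) \<in> (\<lambda>s. (s, Suc s)) ` succession_starts n \<pi>"
      by (auto simp: succession_starts_def)
  next
    assume "(s, t) \<in> (\<lambda>s. (s, Suc s)) ` succession_starts n \<pi>"
    then show "(s, t) \<in> mesh12_occurrences pattern1 n \<pi>"
      by (auto simp: mesh12_occurrences_def pattern1_def succession_starts_def eval_nat_numeral)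
  qed
qed

lemma pattern2_occurrences:
  assumes \<pi>: "\<pi> permutes {1..n}"
  shows "mesh12_occurrences pattern2 n \<pi> = (\<lambda>s. (s, Suc s)) ` adjacent_records_starts n \<pi>"
proof (rule set_eqI, clarify)
  fix s t
  show "(s, t) \<in> mesh12_occurrences pattern2 n \<pi> \<longleftrightarrow>
      (s, t) \<in> (\<lambda>s. (s, Suc s)) ` adjacent_records_starts n \<pi>"
  proof
    assume occ: "(s, t) \<in> mesh12_occurrences pattern2 n \<pi>"
    have t: "t = Suc s"
      by (rule middle_column_shaded_imp_adjacent[OF \<pi> _ occ]) (auto simp: pattern2_def)
    from occ have lt: "1 \<le> s" "Suc s \<le> n" "\<pi> s < \<pi> (Suc s)"
      by (auto simp: mesh12_occurrences_def t)
    have "\<pi> m < \<pi> s" if m: "m \<in> {1..<s}" for m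
    proof -
      from occ have "\<not> (\<pi> s < \<pi> m \<and> \<pi> m < \<pi> (Suc s))" "\<not> (\<pi> (Suc s) < \<pi> m \<and> \<pi> m < Suc n)"
        using m lt by (auto simp: mesh12_occurrences_def pattern2_def t eval_nat_numeral)
      moreover have "\<pi> m \<noteq> \<pi> s" "\<pi> m \<noteq> \<pi> (Suc s)"
        using permutes_inj[OF \<pi>] m by (auto dest!: injD)
      moreover have "\<pi> m \<le> n" using permutes_interval_bounds[OF \<pi>, of m] m lt by auto
      ultimately show ?thesis by linarith
    qed
    with t lt show "(s, t) \<in> (\<lambda>s. (s, Suc s)) ` adjacent_records_starts n \<pi>"
      by (auto simp: adjacent_records_starts_def)
  next
    assume "(s, t) \<in> (\<lambda>s. (s, Suc s)) ` adjacent_records_starts n \<pi>"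
    then have t: "t = Suc s" and s: "1 \<le> s" "s < n" "\<pi> s < \<pi> (Suc s)"
      and rec: "\<And>j. 1 \<le> j \<Longrightarrow> j < s \<Longrightarrow> \<pi> j < \<pi> s"
      by (auto simp: adjacent_records_starts_def)
    have "\<not> \<pi> s < \<pi> j" "\<not> \<pi> (Suc s) < \<pi> j" if "1 \<le> j" "j < s" for j
      using rec[OF that] s by auto
    with s show "(s, t) \<in> mesh12_occurrences pattern2 n \<pi>"
      by (auto simp: t mesh12_occurrences_def pattern2_def eval_nat_numeral)
  qed
qed

section \<open>The recurrence and the initial values\<close>

text \<open>The new letter \<open>1\<close> starts a succession exactly when it stands before the raised
  minimum \<open>2\<close>, and it then separates no succession because nothing is smaller than the minimum.\<close>

lemma T_pattern1_recurrence:
  assumes m: "1 \<le> m"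
  shows "int (T pattern1 (Suc m) k) = int (T pattern1 m (k - 1))
    + (k + 1) * int (T pattern1 m (k + 1)) + (int m - k) * int (T pattern1 m k)"
proof (rule T_recurrence_from_starts[where starts = succession_starts and e = "\<lambda>\<pi>. inv \<pi> 1"])
  fix \<pi> assume \<pi>: "\<pi> permutes {1..m}"
  have "inv \<pi> 1 \<in> {1..m}"
    using permutes_in_image[OF permutes_inv[OF \<pi>], of 1] m by simp
  moreover have "\<pi> (inv \<pi> 1) = 1" using permutes_inverses(1)[OF \<pi>] .
  ultimately show "inv \<pi> 1 \<in> {1..Suc m} \<and> inv \<pi> 1 - 1 \<notin> succession_starts m \<pi>"
    using permutes_interval_bounds(1)[OF \<pi>, of "inv \<pi> 1 - 1"]
    by (auto simp: succession_starts_def)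
next
  fix \<pi> g assume \<pi>: "\<pi> permutes {1..m}" and g: "g \<in> {1..Suc m}"
  show "g \<in> succession_starts (Suc m) (insert_min m \<pi> g) \<longleftrightarrow> g = inv \<pi> 1"
  proof -
    have "g = inv \<pi> 1 \<longleftrightarrow> \<pi> g = 1"
      using permutes_inverses[OF \<pi>] by metis
    moreover have "inv \<pi> 1 \<in> {1..m}"
      using permutes_in_image[OF permutes_inv[OF \<pi>], of 1] m by simp
    ultimately show ?thesis
      using g m by (auto simp: succession_starts_def insert_min_def)
  qed
qed (auto simp: pattern1_occurrences succession_starts_def insert_min_def)

text \<open>The new letter \<open>1\<close> is a left-to-right maximum only at the front, where the old first
  letter, always a left-to-right maximum, follows it.\<close>

lemma T_pattern2_recurrence:
  assumes m: "1 \<le> m"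
  shows "int (T pattern2 (Suc m) k) = int (T pattern2 m (k - 1))
    + (k + 1) * int (T pattern2 m (k + 1)) + (int m - k) * int (T pattern2 m k)"
proof (rule T_recurrence_from_starts[where starts = adjacent_records_starts and e = "\<lambda>_. 1"])
  fix \<pi> g s
  assume \<pi>: "\<pi> permutes {1..m}" and g: "g \<in> {1..Suc m}" and s: "Suc s < g"
  show "s \<in> adjacent_records_starts (Suc m) (insert_min m \<pi> g) \<longleftrightarrow>
      s \<in> adjacent_records_starts m \<pi>"
    using g s by (auto simp: adjacent_records_starts_def insert_min_def)
next
  fix \<pi> g
  assume \<pi>: "\<pi> permutes {1..m}" and g: "g \<in> {1..Suc m}"
  show "g \<in> adjacent_records_starts (Suc m) (insert_min m \<pi> g) \<longleftrightarrow> g = 1"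
  proof (cases "g = 1")
    case True
    then show ?thesis
      using m permutes_interval_bounds(1)[OF \<pi>, of 1]
      by (auto simp: adjacent_records_starts_def insert_min_def)
  next
    case False
    then have "1 \<in> {1..<g}" "\<not> insert_min m \<pi> g 1 < insert_min m \<pi> g g"
      using g by (auto simp: insert_min_def)
    with False show ?thesis by (auto simp: adjacent_records_starts_def)
  qed
next
  fix \<pi> g s
  assume \<pi>: "\<pi> permutes {1..m}" and g: "g \<in> {1..Suc m}" and s: "g \<le> s"
  show "Suc s \<in> adjacent_records_starts (Suc m) (insert_min m \<pi> g) \<longleftrightarrow>
      s \<in> adjacent_records_starts m \<pi>"
  proof (cases "s < m")
    case False
    then show ?thesis by (auto simp: adjacent_records_starts_def)
  next
    case True
    let ?\<sigma> = "insert_min m \<pi> g"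
    have pos: "1 \<le> \<pi> s" using permutes_interval_bounds(1)[OF \<pi>, of s] g s True by auto
    have "(\<forall>j \<in> {1..<Suc s}. ?\<sigma> j < Suc (\<pi> s)) \<longleftrightarrow> (\<forall>j \<in> {1..<s}. \<pi> j < \<pi> s)"
    proof
      assume L: "\<forall>j \<in> {1..<Suc s}. ?\<sigma> j < Suc (\<pi> s)"
      show "\<forall>j \<in> {1..<s}. \<pi> j < \<pi> s"
      proof
        fix j assume "j \<in> {1..<s}"
        then show "\<pi> j < \<pi> s"
          using L[rule_format, of "if j < g then j else Suc j"] g s True
          by (cases "j < g") (auto simp: insert_min_def)
      qed
    next
      assume R: "\<forall>j \<in> {1..<s}. \<pi> j < \<pi> s"
      show "\<forall>j \<in> {1..<Suc s}. ?\<sigma> j < Suc (\<pi> s)"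
      proof
        fix j assume "j \<in> {1..<Suc s}"
        moreover have "\<pi> (j - 1) < \<pi> s" if "g < j"
        proof -
          have "j - 1 \<in> {1..<s}" using \<open>j \<in> {1..<Suc s}\<close> that g by auto
          then show ?thesis using R by blast
        qed
        ultimately show "?\<sigma> j < Suc (\<pi> s)"
          using R g s True pos
          by (cases j g rule: linorder_cases) (auto simp: insert_min_def)
      qed
    qed
    moreover have "?\<sigma> (Suc s) = Suc (\<pi> s)" "?\<sigma> (Suc (Suc s)) = Suc (\<pi> (Suc s))"
      using g s True by (auto simp: insert_min_def)
    ultimately show ?thesis
      using g s True by (auto simp: adjacent_records_starts_def)
  qed
qed (auto simp: pattern2_occurrences adjacent_records_starts_def insert_min_def)

lemma T_eq_0_of_ge:
  assumes p: "p = pattern1 \<or> p = pattern2" and n: "1 \<le> n" and k: "int n \<le> k"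
  shows "T p n k = 0"
proof -
  have "card (mesh12_occurrences p n \<pi>) < n" if \<pi>: "\<pi> permutes {1..n}" for \<pi>
  proof -
    have "mesh12_occurrences p n \<pi> \<subseteq> (\<lambda>s. (s, Suc s)) ` {1..<n}"
      using p pattern1_occurrences[OF \<pi>] pattern2_occurrences[OF \<pi>]
      by (auto simp: succession_starts_def adjacent_records_starts_def)
    then have "card (mesh12_occurrences p n \<pi>) \<le> card {1..<n}"
      by (intro surj_card_le) auto
    then show ?thesis using n by simp
  qed
  then have "{\<pi>. \<pi> permutes {1..n} \<and> int (card (mesh12_occurrences p n \<pi>)) = k} = {}"
    using k by fastforce
  then show ?thesis by (simp only: T_def card.empty)
qed

lemma T_eq_0_of_neg: "k < 0 \<Longrightarrow> T p n k = 0"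
  by (auto simp: T_def intro!: card_eq_0_iff[THEN iffD2])

lemma T_1_0:
  shows "T p 1 0 = 1"
proof -
  have "mesh12_occurrences p 1 id = {}" by (auto simp: mesh12_occurrences_def)
  then have "{\<pi>. \<pi> permutes {1..1::nat} \<and> int (card (mesh12_occurrences p 1 \<pi>)) = 0} = {id}"
    by (auto simp: permutes_sing)
  then show ?thesis by (simp only: T_def) simp
qed

theorem theorem4p2:
  fixes p :: "(nat \<times> nat) set"
  assumes "p = pattern1 \<or> p = pattern2"
  shows
    "((\<forall>n::nat. \<forall>k::int. n \<ge> 3 \<longrightarrow> k \<ge> 0 \<longrightarrow>
        int (T p n k) = int (T p (n - 1) (k - 1)) + (k + 1) * int (T p (n - 1) (k + 1))
                        + (int n - k - 1) * int (T p (n - 1) k))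
      \<and> T p 1 0 = 1 \<and> T p 2 0 = 1 \<and> T p 2 1 = 1)
     \<and>
     ((\<forall>n::nat. n \<ge> 3 \<longrightarrow>
        T_poly p n = [:int n - 1, 1:] * T_poly p (n - 1) + [:1, -1:] * pderiv (T_poly p (n - 1)))
      \<and> T_poly p 1 = 1 \<and> T_poly p 2 = [:1, 1:])"
proof -
  have rec: "int (T p n k) = int (T p (n - 1) (k - 1)) + (k + 1) * int (T p (n - 1) (k + 1))
                        + (int n - k - 1) * int (T p (n - 1) k)" if "2 \<le> n" for n k
    using assms T_pattern1_recurrence[of "n - 1" k] T_pattern2_recurrence[of "n - 1" k] that
    by (auto simp: of_nat_diff algebra_simps)
  note vanish = T_eq_0_of_ge[OF assms] T_eq_0_of_neg
  have T2: "T p 2 0 = 1" "T p 2 1 = 1"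
    using rec[of 2 0] rec[of 2 1] T_1_0[of p] by (simp_all add: vanish)
  have coeff: "coeff (T_poly p n) k = int (T p n (int k))" if "1 \<le> n" for n k
    using that by (simp add: T_poly_def coeff_sum coeff_monom sum.delta vanish)
  have "T_poly p n = [:int n - 1, 1:] * T_poly p (n - 1)
      + [:1, -1:] * pderiv (T_poly p (n - 1))" if n: "3 \<le> n" for n
  proof (rule poly_eqI)
    fix k
    show "coeff (T_poly p n) k = coeff ([:int n - 1, 1:] * T_poly p (n - 1)
      + [:1, -1:] * pderiv (T_poly p (n - 1))) k"
      using n rec[of n "int k"]
      by (cases k) (simp_all add: coeff coeff_pderiv vanish algebra_simps)
  qed
  moreover have "T_poly p 1 = 1" "T_poly p 2 = [:1, 1:]"
    using T_1_0[of p] T2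
    by (simp_all add: T_poly_def eval_nat_numeral monom_altdef one_pCons)
  ultimately show ?thesis using rec T_1_0[of p] T2 by simp
qed

end
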